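(* Let $T$ be the iceberg transformation of $(X,\mu)$ defined by a sequence of integers $q_n\ge2$ and rotations $\alpha_{n,y}\in\{0,\dots,h_n-1\}$ ($n\ge0$, $0\le y\le q_n-1$), and suppose that $q_n\to\infty$ as $n\to\infty$. Then $T$ is of $1/4$-local rank.
   Context: Iceberg transformation (without spacers): let $q_n\ge 2$ be integers, $h_0=1$, $h_{n+1}=q_nh_n$, and let $\alpha_{n,y}\in\{0,\dots,h_n-1\}$ for $n\ge0$, $0\le y\le q_n-1$. Let $X_n=\{0,1,\dots,h_n-1\}$ (identified with $\mathbb{Z}/h_n\mathbb{Z}$) with uniform probability measure $\mu_n$. Define $\phi_n:X_{n+1}\to X_n$ by $\phi_n(yh_n+t)=t-\alpha_{n,y} \pmod{h_n}$ for $0\le t<h_n$, $0\le y\le q_n-1$. Let $X=\{x=(x_0,x_1,\dots): x_n\in X_n,\ \phi_n(x_{n+1})=x_n \text{ for all } n\}$ be the inverse limit, with the Borel probability measure $\mu$ satisfying $\mu(\{x: x_n=t\})=h_n^{-1}$ for all $n$ and $t\in X_n$. A point $x$ is regular if there is $n_0$ such that $\phi_n(x_{n+1}+1)=x_n+1$ for all $n\ge n_0$ (where $x_n+1$ is taken modulo $h_n$); $\mu$-almost every point is regular. For regular $x$, $Tx$ is the point of $X$ with $(Tx)_n=x_n+1 \pmod{h_n}$ for all $n\ge n_0$, the coordinates with $n<n_0$ being determined by $(Tx)_n=\phi_n((Tx)_{n+1})$. Local rank: a Rokhlin tower of height $h$ is a sequence of disjoint measurable sets $\mathcal{T}=\{C,TC,\dots,T^{h-1}C\}$,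 called its levels; $\cup\mathcal{T}$ denotes their union. The local rank $\beta(T)$ is the maximal $\beta$ for which there is a sequence of Rokhlin towers $\mathcal{T}_n$ with $\mu(\cup\mathcal{T}_n)\to\beta$ such that for every measurable set $A$ there exist measurable sets $A_n$ with $\mu(A_n\triangle A)\to0$, where each $A_n$ is measurable with respect to the partition of $X$ into the levels of $\mathcal{T}_n$ and the single points outside $\cup\mathcal{T}_n$ (that is, $A_n\cap(\cup\mathcal{T}_n)$ is a union of levels of $\mathcal{T}_n$). "$T$ is of $1/4$-local rank" means $\beta(T)\ge 1/4$. *)

theory Defs
  imports "HOL-Probability.Probability"
begin

section \<open>Local rank\<close>

definition tower_union :: "('a \<Rightarrow> 'a) \<Rightarrow> 'a set \<Rightarrow> nat \<Rightarrow> 'a set" where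
  "tower_union T C h = (\<Union>i<h. (T ^^ i) ` C)"

definition rokhlin_tower :: "'a measure \<Rightarrow> ('a \<Rightarrow> 'a) \<Rightarrow> 'a set \<Rightarrow> nat \<Rightarrow> bool" where
  "rokhlin_tower M T C h \<longleftrightarrow>
     h \<ge> 1 \<and> (\<forall>i<h. (T ^^ i) ` C \<in> sets M) \<and> disjoint_family_on (\<lambda>i. (T ^^ i) ` C) {..<h}"

definition tower_measurable :: "'a measure \<Rightarrow> ('a \<Rightarrow> 'a) \<Rightarrow> 'a set \<Rightarrow> nat \<Rightarrow> 'a set \<Rightarrow> bool" where
  "tower_measurable M T C h A \<longleftrightarrow>
     A \<in> sets M \<and> (\<exists>J\<subseteq>{..<h}. A \<inter> tower_union T C h = (\<Union>i\<in>J. (T ^^ i) ` C))"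

definition local_rank_value :: "'a measure \<Rightarrow> ('a \<Rightarrow> 'a) \<Rightarrow> real \<Rightarrow> bool" where
  "local_rank_value M T \<beta> \<longleftrightarrow>
     (\<exists>C h. (\<forall>n. rokhlin_tower M T (C n) (h n)) \<and>
        (\<lambda>n. measure M (tower_union T (C n) (h n))) \<longlonglongrightarrow> \<beta> \<and>
        (\<forall>A\<in>sets M. \<exists>A'. (\<forall>n. tower_measurable M T (C n) (h n) (A' n)) \<and>
           (\<lambda>n. measure M (sym_diff (A' n) A)) \<longlonglongrightarrow> 0))"

text \<open>
  On a probability space whose measure algebra is separable, the admissible values form a closed subset
  of \<open>{0..1}\<close> containing \<open>0\<close> (towers with empty base), so the maximum below is attained.
\<close>

definition local_rank :: "'a measure \<Rightarrow> ('a \<Rightarrow> 'a) \<Rightarrow> real" where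
  "local_rank M T = (GREATEST \<beta>. local_rank_value M T \<beta>)"

section \<open>Iceberg transformations\<close>

definition iceberg_h :: "(nat \<Rightarrow> nat) \<Rightarrow> nat \<Rightarrow> nat" where
  "iceberg_h q n = (\<Prod>i<n. q i)"

text \<open>The subtraction of \<open>\<alpha>\<close> is carried out in the integers, since it truncates on \<^typ>\<open>nat\<close>.\<close>

definition iceberg_phi :: "(nat \<Rightarrow> nat) \<Rightarrow> (nat \<Rightarrow> nat \<Rightarrow> nat) \<Rightarrow> nat \<Rightarrow> nat \<Rightarrow> nat" where
  "iceberg_phi q \<alpha> n x =
     (let y = x div iceberg_h q n; t = x mod iceberg_h q n
      in nat ((int t - int (\<alpha> n y)) mod int (iceberg_h q n)))"

definition iceberg_space :: "(nat \<Rightarrow> nat) \<Rightarrow> (nat \<Rightarrow> nat \<Rightarrow> nat) \<Rightarrow> (nat \<Rightarrow> nat) set" where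
  "iceberg_space q \<alpha> =
     {x. (\<forall>n. x n < iceberg_h q n) \<and> (\<forall>n. iceberg_phi q \<alpha> n (x (Suc n)) = x n)}"

text \<open>
  Here \<^term>\<open>borel :: (nat \<Rightarrow> nat) measure\<close> refers to the product topology of discrete spaces, so its
  restriction is the Borel sigma-algebra of the inverse limit.
\<close>

definition iceberg_measure ::
    "(nat \<Rightarrow> nat) \<Rightarrow> (nat \<Rightarrow> nat \<Rightarrow> nat) \<Rightarrow> (nat \<Rightarrow> nat) measure \<Rightarrow> bool" where
  "iceberg_measure q \<alpha> M \<longleftrightarrow>
     prob_space M \<and> sets M = sets (restrict_space borel (iceberg_space q \<alpha>)) \<and>
     (\<forall>n. \<forall>t<iceberg_h q n. measure M {x \<in> iceberg_space q \<alpha>. x n = t} = 1 / real (iceberg_h q n))"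

definition iceberg_regular_from ::
    "(nat \<Rightarrow> nat) \<Rightarrow> (nat \<Rightarrow> nat \<Rightarrow> nat) \<Rightarrow> nat \<Rightarrow> (nat \<Rightarrow> nat) \<Rightarrow> bool" where
  "iceberg_regular_from q \<alpha> n0 x \<longleftrightarrow>
     (\<forall>n\<ge>n0. iceberg_phi q \<alpha> n ((x (Suc n) + 1) mod iceberg_h q (Suc n))
            = (x n + 1) mod iceberg_h q n)"

definition iceberg_regular ::
    "(nat \<Rightarrow> nat) \<Rightarrow> (nat \<Rightarrow> nat \<Rightarrow> nat) \<Rightarrow> (nat \<Rightarrow> nat) \<Rightarrow> bool" where
  "iceberg_regular q \<alpha> x \<longleftrightarrow> (\<exists>n0. iceberg_regular_from q \<alpha> n0 x)"

text \<open>
  The transformation is only defined at regular points, which have full measure. It is extended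
  by the identity; disjointness of the levels of a Rokhlin tower then forces all points of all
  levels but the last to be regular, so the extension has no effect on towers and on the local rank.
\<close>

definition iceberg_T ::
    "(nat \<Rightarrow> nat) \<Rightarrow> (nat \<Rightarrow> nat \<Rightarrow> nat) \<Rightarrow> (nat \<Rightarrow> nat) \<Rightarrow> (nat \<Rightarrow> nat)" where
  "iceberg_T q \<alpha> x =
     (if iceberg_regular q \<alpha> x
      then THE z. z \<in> iceberg_space q \<alpha> \<and>
             (\<exists>n0. iceberg_regular_from q \<alpha> n0 x \<and> (\<forall>n\<ge>n0. z n = (x n + 1) mod iceberg_h q n))
      else x)"

section \<open>Well-definedness\<close>

lemma iceberg_h_pos: "(\<forall>n. q n \<ge> 2) \<Longrightarrow> iceberg_h q n > 0"
  unfolding iceberg_h_def by (intro prod_pos) (metis not_numeral_le_zero not_gr_zero)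

lemma iceberg_h_Suc: "iceberg_h q (Suc n) = q n * iceberg_h q n"
  by (simp add: iceberg_h_def)

lemma iceberg_phi_less:
  assumes "\<forall>n. q n \<ge> 2"
  shows "iceberg_phi q \<alpha> n x < iceberg_h q n"
  using iceberg_h_pos[OF assms, of n] by (simp add: iceberg_phi_def Let_def nat_less_iff)

lemma iceberg_space_eqI:
  assumes "z \<in> iceberg_space q \<alpha>" "z' \<in> iceberg_space q \<alpha>" "\<And>n. n \<ge> n0 \<Longrightarrow> z n = z' n"
  shows "z = z'"
proof
  fix n
  have "z (n0 - k) = z' (n0 - k)" for k
  proof (induction k)
    case (Suc k)
    show ?case
    proof (cases "k < n0")
      case True
      then have "n0 - k = Suc (n0 - Suc k)" by simp
      with Suc show ?thesis
        using assms(1,2) unfolding iceberg_space_def by (metis (mono_tags, lifting) mem_Collect_eq)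
    qed (use Suc in simp)
  qed (use assms(3) in simp)
  from this[of "n0 - n"] show "z n = z' n"
    using assms(3)[of n] by (cases "n \<ge> n0") auto
qed

lemma iceberg_T_ex1:
  assumes q: "\<forall>n. q n \<ge> 2" and reg: "iceberg_regular q \<alpha> x"
  shows "\<exists>!z. z \<in> iceberg_space q \<alpha> \<and>
    (\<exists>n0. iceberg_regular_from q \<alpha> n0 x \<and> (\<forall>n\<ge>n0. z n = (x n + 1) mod iceberg_h q n))"
proof -
  from reg obtain n0 where n0: "iceberg_regular_from q \<alpha> n0 x"
    by (auto simp: iceberg_regular_def)
  define d where "d = rec_nat ((x n0 + 1) mod iceberg_h q n0) (\<lambda>k v. iceberg_phi q \<alpha> (n0 - Suc k) v)"
  define z where "z n = (if n \<ge> n0 then (x n + 1) mod iceberg_h q n else d (n0 - n))" for n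
  have d0: "d 0 = (x n0 + 1) mod iceberg_h q n0" 
    and dS: "d (Suc k) = iceberg_phi q \<alpha> (n0 - Suc k) (d k)" for k
    by (simp_all add: d_def)
  have "iceberg_phi q \<alpha> n (z (Suc n)) = z n" for n
  proof (cases "n \<ge> n0")
    case True
    then show ?thesis using n0 by (simp add: z_def iceberg_regular_from_def)
  next
    case False
    have "z (Suc n) = d (n0 - Suc n)"
      using False by (auto simp: z_def d0 le_Suc_eq not_le)
    moreover have "n0 - n = Suc (n0 - Suc n)" "n0 - Suc (n0 - Suc n) = n" using False by auto
    ultimately show ?thesis using False dS[of "n0 - Suc n"] by (simp add: z_def)
  qed
  moreover from this have "z n < iceberg_h q n" for n
    using iceberg_phi_less[OF q] by metis
  ultimately have z: "z \<in> iceberg_space q \<alpha>" by (simp add: iceberg_space_def)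
  show ?thesis
  proof (rule ex1I[of _ z])
    show "z \<in> iceberg_space q \<alpha> \<and> (\<exists>n0. iceberg_regular_from q \<alpha> n0 x \<and>
            (\<forall>n\<ge>n0. z n = (x n + 1) mod iceberg_h q n))"
      using z n0 by (auto simp: z_def)
  next
    fix z' assume *: "z' \<in> iceberg_space q \<alpha> \<and> (\<exists>n0. iceberg_regular_from q \<alpha> n0 x \<and>
            (\<forall>n\<ge>n0. z' n = (x n + 1) mod iceberg_h q n))"
    then obtain n1 where n1: "\<And>n. n \<ge> n1 \<Longrightarrow> z' n = (x n + 1) mod iceberg_h q n" by auto
    show "z' = z"
      by (rule iceberg_space_eqI[of _ q \<alpha> _ "max n0 n1"]) (use * z n1 in \<open>auto simp: z_def\<close>)
  qed
qed

text \<open>Digit expansion: the points of the inverse limit correspond to the sequences \<open>w\<close> with \<open>w n < q n\<close>.\<close>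

fun iceberg_point :: "(nat \<Rightarrow> nat) \<Rightarrow> (nat \<Rightarrow> nat \<Rightarrow> nat) \<Rightarrow> (nat \<Rightarrow> nat) \<Rightarrow> nat \<Rightarrow> nat" where
  "iceberg_point q \<alpha> w 0 = 0"
| "iceberg_point q \<alpha> w (Suc n) =
     w n * iceberg_h q n + (iceberg_point q \<alpha> w n + \<alpha> n (w n)) mod iceberg_h q n"

lemma iceberg_point_less:
  assumes q: "\<forall>n. q n \<ge> 2" and w: "\<forall>n. w n < q n"
  shows "iceberg_point q \<alpha> w n < iceberg_h q n"
proof (cases n)
  case (Suc m)
  have "(iceberg_point q \<alpha> w m + \<alpha> m (w m)) mod iceberg_h q m < iceberg_h q m"
    using iceberg_h_pos[OF q] by simp
  then have "iceberg_point q \<alpha> w (Suc m) < Suc (w m) * iceberg_h q m" by simp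
  also have "\<dots> \<le> q m * iceberg_h q m" using spec[OF w, of m] by (intro mult_right_mono) auto
  finally show ?thesis using Suc by (simp add: iceberg_h_Suc)
qed (simp add: iceberg_h_def)

lemma iceberg_phi_point:
  assumes q: "\<forall>n. q n \<ge> 2" and t: "t < iceberg_h q n"
  shows "iceberg_phi q \<alpha> n (y * iceberg_h q n + (t + \<alpha> n y) mod iceberg_h q n) = t"
proof -
  have "(int ((t + \<alpha> n y) mod iceberg_h q n) - int (\<alpha> n y)) mod int (iceberg_h q n)
        = (int t + int (\<alpha> n y) - int (\<alpha> n y)) mod int (iceberg_h q n)"
    by (simp add: zmod_int mod_diff_left_eq)
  also have "\<dots> = int t" using t by simp
  finally show ?thesis
    using iceberg_h_pos[OF q, of n] by (simp add: iceberg_phi_def Let_def)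
qed

lemma iceberg_point_in_space:
  assumes q: "\<forall>n. q n \<ge> 2" and w: "\<forall>n. w n < q n"
  shows "iceberg_point q \<alpha> w \<in> iceberg_space q \<alpha>"
proof -
  have "iceberg_phi q \<alpha> n (iceberg_point q \<alpha> w (Suc n)) = iceberg_point q \<alpha> w n" for n
    unfolding iceberg_point.simps by (rule iceberg_phi_point[OF q iceberg_point_less[OF q w]])
  then show ?thesis
    using iceberg_point_less[OF q w] unfolding iceberg_space_def by blast
qed

lemma iceberg_point_cylinder:
  assumes q: "\<forall>n. q n \<ge> 2" and t: "t < iceberg_h q n"
  shows "\<exists>a. (\<forall>i<n. a i < q i) \<and>
    (\<forall>w. (\<forall>i. w i < q i) \<longrightarrow> (iceberg_point q \<alpha> w n = t \<longleftrightarrow> (\<forall>i<n. w i = a i)))"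
  using t
proof (induction n arbitrary: t)
  case 0
  then show ?case by (auto simp: iceberg_h_def)
next
  case (Suc n)
  define y where "y = t div iceberg_h q n"
  define s where "s = iceberg_phi q \<alpha> n t"
  have hp: "iceberg_h q n > 0" by (rule iceberg_h_pos[OF q])
  have s: "s < iceberg_h q n" unfolding s_def by (rule iceberg_phi_less[OF q])
  have y: "y < q n"
    using Suc.prems hp by (simp add: y_def iceberg_h_Suc less_mult_imp_div_less)
  have "int ((s + \<alpha> n y) mod iceberg_h q n) = int (t mod iceberg_h q n)"
    using hp by (simp add: s_def y_def iceberg_phi_def Let_def zmod_int mod_add_left_eq)
  then have t_eq: "t = y * iceberg_h q n + (s + \<alpha> n y) mod iceberg_h q n"
    by (simp only: of_nat_eq_iff) (simp only: y_def div_mult_mod_eq)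
  obtain a where a: "\<forall>i<n. a i < q i"
    "\<And>w. (\<forall>i. w i < q i) \<Longrightarrow> iceberg_point q \<alpha> w n = s \<longleftrightarrow> (\<forall>i<n. w i = a i)"
    using Suc.IH[OF s] by blast
  have "iceberg_point q \<alpha> w (Suc n) = t \<longleftrightarrow> (\<forall>i<Suc n. w i = (a(n := y)) i)"
    if w: "\<forall>i. w i < q i" for w
  proof -
    have "iceberg_point q \<alpha> w (Suc n) = t \<longleftrightarrow> iceberg_point q \<alpha> w n = s \<and> w n = y"
    proof
      assume eq: "iceberg_point q \<alpha> w (Suc n) = t"
      have "s = iceberg_point q \<alpha> w n"
        unfolding s_def eq[symmetric]
        using iceberg_phi_point[OF q iceberg_point_less[OF q]] w by simp
      moreover have "w n = y" unfolding y_def eq[symmetric] using hp by simp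
      ultimately show "iceberg_point q \<alpha> w n = s \<and> w n = y" by simp
    qed (use t_eq in auto)
    then show ?thesis using a(2)[OF w] by (auto simp: less_Suc_eq)
  qed
  moreover have "\<forall>i<Suc n. (a(n := y)) i < q i" using a(1) y by (auto simp: less_Suc_eq)
  ultimately show ?case by blast
qed

theorem iceberg_measure_exists:
  assumes q: "\<forall>n. q n \<ge> 2"
  shows "\<exists>M. iceberg_measure q \<alpha> M"
proof -
  define U where "U n = uniform_count_measure {..<q n}" for n
  have ne: "{..<q n} \<noteq> {}" for n using spec[OF q, of n] by (auto simp: lessThan_empty_iff)
  interpret product_prob_space U UNIV
    unfolding product_prob_space_def product_prob_space_axioms_def product_sigma_finite_def U_def
    using prob_space_uniform_count_measure[OF _ ne] prob_space_imp_sigma_finite by blast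
  let ?P = "Pi\<^sub>M UNIV U" and ?f = "iceberg_point q \<alpha>"
  have spU: "space (U n) = {..<q n}" and seU: "sets (U n) = Pow {..<q n}" for n
    by (simp_all add: U_def space_uniform_count_measure sets_uniform_count_measure)
  have w: "\<forall>n. w n < q n" if "w \<in> space ?P" for w
    using that by (auto simp: space_PiM spU)
  have cyl: "{w \<in> space ?P. ?f w n = t} \<in> sets ?P \<and>
       measure ?P {w \<in> space ?P. ?f w n = t} = 1 / real (iceberg_h q n)"
    if "t < iceberg_h q n" for n t
  proof -
    obtain a where a: "\<forall>i<n. a i < q i"
      "\<And>w. (\<forall>i. w i < q i) \<Longrightarrow> ?f w n = t \<longleftrightarrow> (\<forall>i<n. w i = a i)"
      using iceberg_point_cylinder[OF q \<open>t < _\<close>] by blast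
    have eq: "{w \<in> space ?P. ?f w n = t} = {w \<in> space ?P. \<forall>i\<in>{..<n}. w i \<in> {a i}}"
      using a(2) w by auto
    have ms: "{a i} \<in> sets (U i)" if "i \<in> {..<n}" for i using that a(1) by (auto simp: seU)
    have "emeasure ?P {w \<in> space ?P. ?f w n = t} = (\<Prod>i<n. emeasure (U i) {a i})"
      unfolding eq by (rule emeasure_PiM_Collect) (use ms in auto)
    also have "\<dots> = (\<Prod>i<n. ennreal (1 / real (q i)))"
      using a(1) by (intro prod.cong) 
        (auto simp: U_def emeasure_uniform_count_measure)
    also have "\<dots> = ennreal (1 / real (iceberg_h q n))"
      by (simp add: prod_ennreal iceberg_h_def prod_dividef)
    finally have "measure ?P {w \<in> space ?P. ?f w n = t} = 1 / real (iceberg_h q n)"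
      by (simp add: measure_def)
    moreover have "{w \<in> space ?P. ?f w n = t} \<in> sets ?P"
    proof -
      have "{w \<in> space ?P. w i \<in> {a i}} \<in> sets ?P" if "i \<in> {..<n}" for i
        using measurable_sets[OF measurable_component_singleton[of i UNIV U] ms[OF that]]
        by (simp add: vimage_def Int_def conj_commute)
      then show ?thesis unfolding eq by (intro sets.sets_Collect_finite_All) auto
    qed
    ultimately show ?thesis by simp
  qed
  have "(\<lambda>w. ?f w n) \<in> measurable ?P (count_space UNIV)" for n
  proof (subst measurable_count_space_eq_countable, simp, intro conjI ballI)
    fix t
    show "(\<lambda>w. ?f w n) -` {t} \<inter> space ?P \<in> sets ?P"
    proof (cases "t < iceberg_h q n")
      case True
      then have "{w \<in> space ?P. ?f w n = t} \<in> sets ?P" using cyl by blast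
      also have "{w \<in> space ?P. ?f w n = t} = (\<lambda>w. ?f w n) -` {t} \<inter> space ?P" by auto
      finally show ?thesis .
    next
      case False
      then have "(\<lambda>w. ?f w n) -` {t} \<inter> space ?P = {}"
        using iceberg_point_less[OF q w, of _ \<alpha> n] by auto
      then show ?thesis by (metis sets.empty_sets)
    qed
  qed auto
  then have "(\<lambda>w. ?f w n) \<in> measurable ?P borel" for n
    by (rule measurable_compose[where g = "\<lambda>k. k"]) simp
  then have "?f \<in> measurable ?P (Pi\<^sub>M UNIV (\<lambda>_. borel))"
    by (intro measurable_PiM_single') auto
  then have fb: "?f \<in> measurable ?P borel"
    by (simp add: measurable_cong_sets[OF refl sets_PiM_equal_borel])
  have f: "?f \<in> measurable ?P (restrict_space borel (iceberg_space q \<alpha>))"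
    by (rule measurable_restrict_space2) (use fb iceberg_point_in_space[OF q w] in auto)
  let ?M = "distr ?P (restrict_space borel (iceberg_space q \<alpha>)) ?f"
  have "measure ?M {x \<in> iceberg_space q \<alpha>. x n = t} = 1 / real (iceberg_h q n)"
    if "t < iceberg_h q n" for n t
  proof -
    have "(\<lambda>x::nat \<Rightarrow> nat. x n) \<in> measurable borel borel"
      by (intro borel_measurable_continuous_onI continuous_on_product_coordinates)
    then have "(\<lambda>x::nat \<Rightarrow> nat. x n) -` {t} \<inter> space borel \<in> sets borel"
      by (rule measurable_sets) simp
    then have "iceberg_space q \<alpha> \<inter> (\<lambda>x. x n) -` {t} \<in> sets (restrict_space borel (iceberg_space q \<alpha>))"
      by (simp add: sets_restrict_space)
    then have "{x \<in> iceberg_space q \<alpha>. x n = t} \<in> sets (restrict_space borel (iceberg_space q \<alpha>))"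
      by (simp add: vimage_def Int_def)
    then have "measure ?M {x \<in> iceberg_space q \<alpha>. x n = t}
        = measure ?P (?f -` {x \<in> iceberg_space q \<alpha>. x n = t} \<inter> space ?P)"
      by (rule measure_distr[OF f])
    also have "?f -` {x \<in> iceberg_space q \<alpha>. x n = t} \<inter> space ?P = {w \<in> space ?P. ?f w n = t}"
      using iceberg_point_in_space[OF q w] by auto
    finally show ?thesis using cyl[OF \<open>t < _\<close>] by simp
  qed
  moreover have "prob_space ?M" by (rule prob_space_distr[OF f])
  ultimately show ?thesis unfolding iceberg_measure_def by (intro exI[of _ ?M]) simp
qed

end

theory Submission
  imports Defs
begin

text \<open>
  Cut \<open>{0..<h (n+1)}\<close> into \<open>q n\<close> blocks of length \<open>h n\<close>. As \<open>x\<^bsub>n+1\<^esub>\<close> runs through a block, \<open>x\<^sub>n\<close> runs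
  once through the whole cycle of length \<open>h n\<close>, from a starting point that depends on the block. Fix
  a window of length \<open>l = h n div 2\<close> in this cycle. The end of a block may cut the window into an
  initial and a final piece; but a block cannot cut both of two complementary windows, so one of them is
  intact in at least half of the blocks (\<open>intact_window\<close>). The points that are in the window, inside
  a block where it is intact, form a tower: its base consists of the points that are at the start of
  the window, \<open>T\<close> moves them through it, and along the way \<open>x\<^sub>n\<close> depends only on the level
  (\<open>level\<close>, \<open>iceberg_T_image_level\<close>). The tower fills about half of half of the blocks, that is,
  measure \<open>1/4\<close> (\<open>prob_tower_union\<close>).

  This description assumes that \<open>T\<close> adds 1 to the coordinates of all stages from \<open>n\<close> on, which fails
  when some coordinate \<open>x\<^bsub>m+1\<^esub>\<close> with \<open>m > n\<close> leaves its block of length \<open>h m\<close> during the \<open>l\<close> steps. Points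
  where this can happen have measure at most \<open>h n / h m\<close>; as \<open>h m\<close> is at least
  \<open>2 ^ (m - n - 1) * q n * h n\<close>, these add up to a multiple of \<open>1 / q n\<close>, and this is where
  \<open>q n \<rightarrow> \<infinity>\<close> enters (\<open>prob_near_later_boundary\<close>).

  Since \<open>x\<^sub>n\<close> is constant on the levels, the tower of stage \<open>n\<close> resolves without error every set that is
  determined by a coordinate of stage at most \<open>n\<close>, and these cylinders are dense in the measure
  algebra (\<open>tower_measurable_cyl\<close>, \<open>cyl_dense\<close>). Hence every limit point of the measures of the
  towers is an admissible value for the local rank, and one of them is at least \<open>1/4\<close>. Finally the
  admissible values are closed under limits, so that the greatest one exists
  (\<open>local_rank_value_le_local_rank\<close>).
\<close>

section \<open>Admissible values of the local rank\<close>

text \<open>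
  Taking for each \<open>n\<close> a choice that is optimal up to \<open>1 / (n + 1)\<close> works for all tolerances at once.
\<close>

lemma choose_vanishing_sequence:
  fixes f :: "nat \<Rightarrow> 'b \<Rightarrow> real"
  assumes ne: "\<And>n. \<exists>x. P n x" and nonneg: "\<And>n x. f n x \<ge> 0"
    and small: "\<And>e. e > 0 \<Longrightarrow> \<forall>\<^sub>F n in sequentially. \<exists>x. P n x \<and> f n x < e"
  shows "\<exists>x. (\<forall>n. P n (x n)) \<and> (\<lambda>n. f n (x n)) \<longlonglongrightarrow> 0"
proof -
  define I where "I n = Inf (f n ` Collect (P n))" for n
  have bdd: "bdd_below (f n ` Collect (P n))" for n
    using nonneg by (intro bdd_belowI[of _ 0]) auto
  have "\<exists>x. P n x \<and> f n x < I n + 1 / real (Suc n)" for n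
  proof -
    have "I n < I n + 1 / real (Suc n)" by simp
    then show ?thesis
      unfolding I_def using cInf_lessD[of "f n ` Collect (P n)"] ne by fastforce
  qed
  then obtain x where x: "\<And>n. P n (x n)" "\<And>n. f n (x n) < I n + 1 / real (Suc n)" by metis
  have "(\<lambda>n. f n (x n)) \<longlonglongrightarrow> 0"
  proof (rule order_tendstoI)
    show "\<forall>\<^sub>F n in sequentially. a < f n (x n)" if "a < 0" for a
      using nonneg that by (intro always_eventually) (meson less_le_trans)
    fix e :: real assume "0 < e"
    then have "\<forall>\<^sub>F n in sequentially. \<exists>x. P n x \<and> f n x < e / 2" by (intro small) simp
    moreover have "\<forall>\<^sub>F n in sequentially. 1 / real (Suc n) < e / 2"
      using order_tendstoD(2)[OF LIMSEQ_inverse_real_of_nat, of "e / 2"] \<open>0 < e\<close>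
      by (simp add: inverse_eq_divide)
    ultimately show "\<forall>\<^sub>F n in sequentially. f n (x n) < e"
    proof eventually_elim
      case (elim n)
      then obtain y where "P n y" "f n y < e / 2" by auto
      then have "I n \<le> f n y" unfolding I_def using bdd by (intro cInf_lower) auto
      with x(2)[of n] \<open>f n y < e / 2\<close> elim(2) show ?case by linarith
    qed
  qed
  with x(1) show ?thesis by blast
qed

lemma tower_measurable_empty: "tower_measurable M T C h {}"
  unfolding tower_measurable_def by (intro conjI exI[of _ "{}"]) auto

lemma (in finite_measure) measure_sym_diff_triangle:
  assumes "A \<in> sets M" "B \<in> sets M" "C \<in> sets M"
  shows "measure M (sym_diff A C) \<le> measure M (sym_diff A B) + measure M (sym_diff B C)"
proof -
  have "measure M (sym_diff A C) \<le> measure M (sym_diff A B \<union> sym_diff B C)"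
    using assms by (intro finite_measure_mono) auto
  also have "\<dots> \<le> measure M (sym_diff A B) + measure M (sym_diff B C)"
    using assms by (intro measure_Un_le) auto
  finally show ?thesis .
qed

text \<open>
  In this form an error in the value \<open>\<beta>\<close> is allowed along with the errors of approximation, so that
  \<open>\<beta>\<close> can be replaced by a nearby value.
\<close>

lemma local_rank_valueD:
  assumes "local_rank_value M T \<beta>" "e > 0" "\<And>k::nat. D k \<in> sets M"
  shows "\<exists>C h. rokhlin_tower M T C h \<and> \<bar>measure M (tower_union T C h) - \<beta>\<bar> < e \<and>
    (\<forall>k<K. \<exists>A. tower_measurable M T C h A \<and> measure M (sym_diff A (D k)) < e)"
proof -
  obtain C h where C: "\<And>n. rokhlin_tower M T (C n) (h n)"
    "(\<lambda>n. measure M (tower_union T (C n) (h n))) \<longlonglongrightarrow> \<beta>"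
    "\<And>A. A \<in> sets M \<Longrightarrow> \<exists>A'. (\<forall>n. tower_measurable M T (C n) (h n) (A' n)) \<and>
           (\<lambda>n. measure M (sym_diff (A' n) A)) \<longlonglongrightarrow> 0"
    using assms(1) unfolding local_rank_value_def by blast
  obtain A' where A': "\<And>k n. tower_measurable M T (C n) (h n) (A' k n)"
    "\<And>k. (\<lambda>n. measure M (sym_diff (A' k n) (D k))) \<longlonglongrightarrow> 0"
    using C(3)[OF assms(3)] by metis
  have "\<forall>\<^sub>F n in sequentially. \<bar>measure M (tower_union T (C n) (h n)) - \<beta>\<bar> < e"
    using tendstoD[OF C(2) assms(2)] by (simp add: dist_real_def)
  moreover have "\<forall>\<^sub>F n in sequentially. \<forall>k\<in>{..<K}. measure M (sym_diff (A' k n) (D k)) < e"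
    using order_tendstoD(2)[OF A'(2) assms(2)] by (intro eventually_ball_finite) auto
  ultimately have "\<forall>\<^sub>F n in sequentially. \<bar>measure M (tower_union T (C n) (h n)) - \<beta>\<bar> < e \<and>
      (\<forall>k\<in>{..<K}. measure M (sym_diff (A' k n) (D k)) < e)"
    by (rule eventually_conj)
  then obtain n where "\<bar>measure M (tower_union T (C n) (h n)) - \<beta>\<bar> < e"
      "\<forall>k\<in>{..<K}. measure M (sym_diff (A' k n) (D k)) < e"
    using eventually_happens'[OF sequentially_bot] by blast
  then show ?thesis using C(1)[of n] A'(1)[of n] by (intro exI[of _ "C n"] exI[of _ "h n"]) blast
qed

text \<open>
  For the converse, one tower per tolerance is enough: if the sets \<open>D k\<close> are dense in the measure
  algebra, it is enough to approximate finitely many of them at a time, and a diagonal choice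
  yields a single sequence of towers that works for all measurable sets.
\<close>

lemma (in finite_measure) local_rank_valueI:
  assumes D: "\<And>k::nat. D k \<in> sets M"
    and dense: "\<And>A e. A \<in> sets M \<Longrightarrow> e > 0 \<Longrightarrow> \<exists>k. measure M (sym_diff (D k) A) < e"
    and towers: "\<And>e K. e > 0 \<Longrightarrow> \<exists>C h. rokhlin_tower M T C h \<and>
      \<bar>measure M (tower_union T C h) - \<beta>\<bar> < e \<and>
      (\<forall>k<K. \<exists>A. tower_measurable M T C h A \<and> measure M (sym_diff A (D k)) < e)"
  shows "local_rank_value M T \<beta>"
proof -
  have "\<exists>C h. rokhlin_tower M T C h \<and>
      \<bar>measure M (tower_union T C h) - \<beta>\<bar> < 1 / real (Suc n) \<and>
      (\<forall>k<n. \<exists>A. tower_measurable M T C h A \<and> measure M (sym_diff A (D k)) < 1 / real (Suc n))"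
    for n by (rule towers) simp
  then obtain C h where C: "\<And>n. rokhlin_tower M T (C n) (h n)"
      "\<And>n. \<bar>measure M (tower_union T (C n) (h n)) - \<beta>\<bar> < 1 / real (Suc n)"
      "\<And>n k. k < n \<Longrightarrow> \<exists>A. tower_measurable M T (C n) (h n) A \<and>
        measure M (sym_diff A (D k)) < 1 / real (Suc n)"
    by metis
  have inv: "(\<lambda>n. 1 / real (Suc n)) \<longlonglongrightarrow> 0"
    using LIMSEQ_inverse_real_of_nat by (simp add: inverse_eq_divide)
  have "(\<lambda>n. measure M (tower_union T (C n) (h n)) - \<beta>) \<longlonglongrightarrow> 0"
    by (rule Lim_null_comparison[OF _ inv]) (use C(2) in \<open>auto intro!: always_eventually less_imp_le\<close>)
  then have "(\<lambda>n. measure M (tower_union T (C n) (h n))) \<longlonglongrightarrow> \<beta>"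
    by (rule LIM_zero_cancel)
  moreover have "\<exists>A'. (\<forall>n. tower_measurable M T (C n) (h n) (A' n)) \<and>
           (\<lambda>n. measure M (sym_diff (A' n) A)) \<longlonglongrightarrow> 0" if A: "A \<in> sets M" for A
  proof (rule choose_vanishing_sequence)
    show "\<exists>A'. tower_measurable M T (C n) (h n) A'" for n using tower_measurable_empty by blast
    fix e :: real assume e: "e > 0"
    then obtain k where k: "measure M (sym_diff (D k) A) < e / 2" using dense[OF A, of "e / 2"] by auto
    have "\<forall>\<^sub>F n in sequentially. 1 / real (Suc n) < e / 2"
      using order_tendstoD(2)[OF inv, of "e / 2"] e by simp
    then show "\<forall>\<^sub>F n in sequentially. \<exists>A'. tower_measurable M T (C n) (h n) A' \<and>
        measure M (sym_diff A' A) < e"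
      using eventually_gt_at_top[of k]
    proof eventually_elim
      case (elim n)
      obtain A' where A': "tower_measurable M T (C n) (h n) A'"
        "measure M (sym_diff A' (D k)) < 1 / real (Suc n)" using C(3)[OF \<open>k < n\<close>] by blast
      have "A' \<in> sets M" using A'(1) by (simp add: tower_measurable_def)
      then have "measure M (sym_diff A' A) < e"
        using measure_sym_diff_triangle[OF _ D A, of A' k] A'(2) elim(1) k by linarith
      with A'(1) show ?case by blast
    qed
  qed simp
  ultimately show ?thesis unfolding local_rank_value_def using C(1) by blast
qed

lemma (in prob_space) local_rank_value_le_1: "local_rank_value M T \<beta> \<Longrightarrow> \<beta> \<le> 1"
  unfolding local_rank_value_def using LIMSEQ_le_const2 prob_le_1 by metis

text \<open>
  The admissible values are closed under limits, because the criterion above tolerates an error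
  in the value; so the supremum of the admissible values is attained and is the local rank.
\<close>

lemma (in prob_space) local_rank_value_le_local_rank:
  assumes D: "\<And>k::nat. D k \<in> sets M"
    and dense: "\<And>A e. A \<in> sets M \<Longrightarrow> e > 0 \<Longrightarrow> \<exists>k. measure M (sym_diff (D k) A) < e"
    and \<beta>: "local_rank_value M T \<beta>"
  shows "\<beta> \<le> local_rank M T"
proof -
  let ?V = "Collect (local_rank_value M T)"
  have bdd: "bdd_above ?V" using local_rank_value_le_1 by (intro bdd_aboveI[of _ 1]) auto
  have upper: "\<gamma> \<le> Sup ?V" if "local_rank_value M T \<gamma>" for \<gamma>
    using that by (intro cSup_upper bdd) simp
  have "local_rank_value M T (Sup ?V)"
  proof (rule local_rank_valueI[OF D dense])
    fix e :: real and K assume e: "e > 0"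
    then obtain \<gamma> where \<gamma>: "local_rank_value M T \<gamma>" "Sup ?V - e / 2 < \<gamma>"
      using less_cSupD[of ?V "Sup ?V - e / 2"] \<beta> by auto
    obtain C h where C: "rokhlin_tower M T C h" "\<bar>measure M (tower_union T C h) - \<gamma>\<bar> < e / 2"
      "\<forall>k<K. \<exists>A. tower_measurable M T C h A \<and> measure M (sym_diff A (D k)) < e / 2"
      using local_rank_valueD[OF \<gamma>(1) half_gt_zero[OF e], of D K, OF D] by blast
    have "\<bar>measure M (tower_union T C h) - Sup ?V\<bar> < e"
      using C(2) \<gamma>(2) upper[OF \<gamma>(1)] by linarith
    moreover have "r < e" if "r < e / 2" for r using that e by simp
    then have "\<forall>k<K. \<exists>A. tower_measurable M T C h A \<and> measure M (sym_diff A (D k)) < e"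
      using C(3) by blast
    ultimately show "\<exists>C h. rokhlin_tower M T C h \<and> \<bar>measure M (tower_union T C h) - Sup ?V\<bar> < e \<and>
      (\<forall>k<K. \<exists>A. tower_measurable M T C h A \<and> measure M (sym_diff A (D k)) < e)"
      using C(1) by blast
  qed
  then have "local_rank M T = Sup ?V"
    unfolding local_rank_def by (intro Greatest_equality upper)
  with upper[OF \<beta>] show ?thesis by simp
qed

section \<open>Combinatorics of the levels\<close>

locale iceberg =
  fixes q :: "nat \<Rightarrow> nat" and \<alpha> :: "nat \<Rightarrow> nat \<Rightarrow> nat"
  assumes q_ge_2: "q n \<ge> 2"
    and alpha_less: "y < q n \<Longrightarrow> \<alpha> n y < iceberg_h q n"
begin

abbreviation "h \<equiv> iceberg_h q"
abbreviation "\<phi> \<equiv> iceberg_phi q \<alpha>"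
abbreviation "X \<equiv> iceberg_space q \<alpha>"
abbreviation "T \<equiv> iceberg_T q \<alpha>"

lemma h_pos: "h n > 0"
  using q_ge_2 by (intro iceberg_h_pos) auto

lemma h_growth: "2 ^ k * h n \<le> h (n + k)"
proof (induction k)
  case (Suc k)
  have "2 ^ Suc k * h n \<le> 2 * h (n + k)" using Suc by simp
  also have "\<dots> \<le> h (n + Suc k)" using q_ge_2[of "n + k"] by (simp add: iceberg_h_Suc)
  finally show ?case .
qed simp

lemma phi_less: "\<phi> n b < h n"
  using q_ge_2 by (intro iceberg_phi_less) auto

lemma spaceD: "x \<in> X \<Longrightarrow> x n < h n" "x \<in> X \<Longrightarrow> \<phi> n (x (Suc n)) = x n"
  by (auto simp: iceberg_space_def)

text \<open>
  Inside a block of length \<open>h n\<close> the projection to stage \<open>n\<close> is a rotation, so it commutes with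
  adding 1 as long as the block is not left.
\<close>

lemma phi_Suc:
  assumes "Suc (b mod h n) < h n"
  shows "\<phi> n (Suc b) = Suc (\<phi> n b) mod h n"
proof -
  have m: "Suc b mod h n = Suc (b mod h n)" and d: "Suc b div h n = b div h n"
    using assms by (auto simp: mod_Suc div_Suc)
  let ?z = "int (b mod h n) - int (\<alpha> n (b div h n))"
  have "int (\<phi> n (Suc b)) = (?z + 1) mod int (h n)"
    using h_pos[of n] by (simp add: iceberg_phi_def Let_def m d algebra_simps)
  also have "\<dots> = (?z mod int (h n) + 1) mod int (h n)" by (simp add: mod_add_left_eq)
  also have "?z mod int (h n) = int (\<phi> n b)"
    using h_pos[of n] by (simp add: iceberg_phi_def Let_def)
  also have "(int (\<phi> n b) + 1) mod int (h n) = int (Suc (\<phi> n b) mod h n)"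
    by (simp add: zmod_int algebra_simps)
  finally show ?thesis by simp
qed

lemma Suc_less_h_Suc:
  assumes "b < h (Suc n)" "Suc (b mod h n) < h n"
  shows "Suc b < h (Suc n)"
proof -
  have "Suc b mod h n \<noteq> 0" using assms(2) by (simp add: mod_Suc)
  then have "Suc b \<noteq> h (Suc n)" by (auto simp: iceberg_h_Suc)
  with assms(1) show ?thesis by simp
qed

text \<open>The coordinates below stage \<open>n\<close> are forced, so a point may be given by a tail of coordinates.\<close>

lemma extend_tail:
  assumes "\<And>m. m \<ge> n \<Longrightarrow> v m < h m" "\<And>m. m \<ge> n \<Longrightarrow> \<phi> m (v (Suc m)) = v m"
  shows "\<exists>x\<in>X. \<forall>m\<ge>n. x m = v m"
  using assms
proof (induction n arbitrary: v)
  case 0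
  then show ?case by (auto simp: iceberg_space_def)
next
  case (Suc n)
  let ?v = "v(n := \<phi> n (v (Suc n)))"
  have "?v m < h m" "\<phi> m (?v (Suc m)) = ?v m" if "m \<ge> n" for m
    using Suc.prems[of m] that phi_less by (cases "m = n"; auto)+
  from Suc.IH[OF this] obtain x where "x \<in> X" "\<forall>m\<ge>n. x m = ?v m" by blast
  then show ?case by (intro bexI[of _ x]) auto
qed

lemma iceberg_T_eqI:
  assumes x: "x \<in> X" and z: "z \<in> X"
    and inner: "\<And>m. m \<ge> n \<Longrightarrow> Suc (x (Suc m) mod h m) < h m"
    and succ: "\<And>m. m \<ge> n \<Longrightarrow> z m = Suc (x m) mod h m"
  shows "T x = z"
proof -
  have "iceberg_regular_from q \<alpha> n x"
    unfolding iceberg_regular_from_def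
  proof (intro allI impI)
    fix m assume m: "n \<le> m"
    have "Suc (x (Suc m)) < h (Suc m)"
      using Suc_less_h_Suc[OF spaceD(1)[OF x] inner[OF m]] .
    then show "\<phi> m ((x (Suc m) + 1) mod h (Suc m)) = (x m + 1) mod h m"
      using phi_Suc[OF inner[OF m]] spaceD(2)[OF x, of m] by simp
  qed
  moreover from this have "iceberg_regular q \<alpha> x" by (auto simp: iceberg_regular_def)
  moreover from this have "\<exists>!z. z \<in> X \<and>
      (\<exists>n0. iceberg_regular_from q \<alpha> n0 x \<and> (\<forall>n\<ge>n0. z n = (x n + 1) mod h n))"
    using q_ge_2 by (intro iceberg_T_ex1) auto
  ultimately show ?thesis
    unfolding iceberg_T_def using z succ by (auto intro!: the1_equality)
qed

text \<open>
  Level \<open>i\<close> of the tower of height \<open>l\<close> over the window \<open>{a, \<dots>, a + l - 1}\<close> of the cycle of length \<open>h n\<close>: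
  the coordinate \<open>x n\<close> is at place \<open>i\<close> of the window, and in every stage from \<open>n + 1\<close> on the preceding
  \<open>i\<close> steps and the following \<open>l - 1 - i\<close> steps stay in the same block. Given explicitly rather than
  as an image of the base, every level is visibly measurable.
\<close>

definition level :: "nat \<Rightarrow> nat \<Rightarrow> nat \<Rightarrow> nat \<Rightarrow> (nat \<Rightarrow> nat) set" where
  "level n a l i = {x \<in> X. x n = (a + i) mod h n \<and>
     (\<forall>m\<ge>n. i \<le> x (Suc m) mod h m \<and> x (Suc m) mod h m + l \<le> h m + i)}"

text \<open>
  Within a level below the top, \<open>T\<close> adds 1 to every coordinate of stage above \<open>n\<close> without leaving its
  block. Conversely, in level \<open>i + 1\<close> one step back is possible within the blocks, and the resulting
  tail of coordinates is a point by the coherence of the projections.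
\<close>

lemma iceberg_T_image_level:
  assumes i: "Suc i < l"
  shows "T ` level n a l i = level n a l (Suc i)"
proof (intro equalityI subsetI)
  fix z assume "z \<in> T ` level n a l i"
  then obtain x where x: "x \<in> level n a l i" "z = T x" by blast
  have xX: "x \<in> X" using x(1) by (simp add: level_def)
  have inner: "Suc (x (Suc m) mod h m) < h m" if "m \<ge> n" for m
  proof -
    have "x (Suc m) mod h m + l \<le> h m + i" using x(1) that by (simp add: level_def)
    with i show ?thesis by linarith
  qed
  have stay: "Suc (x (Suc m)) < h (Suc m)" if "m \<ge> n" for m
    using Suc_less_h_Suc[OF spaceD(1)[OF xX] inner[OF that]] .
  have "\<exists>y\<in>X. \<forall>m\<ge>n. y m = Suc (x m) mod h m"
  proof (rule extend_tail)
    fix m assume m: "m \<ge> n"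
    show "Suc (x m) mod h m < h m" using h_pos by simp
    show "\<phi> m (Suc (x (Suc m)) mod h (Suc m)) = Suc (x m) mod h m"
      using phi_Suc[OF inner[OF m]] stay[OF m] spaceD(2)[OF xX, of m] by simp
  qed
  then obtain y where y: "y \<in> X" "\<And>m. m \<ge> n \<Longrightarrow> y m = Suc (x m) mod h m" by blast
  have "z = y" using iceberg_T_eqI[OF xX y(1) inner y(2)] x(2) by simp
  moreover have "y (Suc m) mod h m = Suc (x (Suc m) mod h m)" if "m \<ge> n" for m
    using y(2)[of "Suc m"] stay[OF that] inner[OF that] that by (simp add: mod_Suc)
  moreover have "y n = (a + Suc i) mod h n"
    using y(2)[of n] x(1) by (simp add: level_def mod_Suc_eq)
  ultimately show "z \<in> level n a l (Suc i)"
    using x(1) y(1) by (simp add: level_def)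
next
  fix z assume z: "z \<in> level n a l (Suc i)"
  have zX: "z \<in> X" using z by (simp add: level_def)
  \<comment> \<open>The coordinates \<open>z m - 1\<close> of the preimage, written so that \<open>z n = 0\<close> wraps around to \<open>h n - 1\<close>.\<close>
  define v where "v m = \<phi> m (z (Suc m) - 1)" for m
  have zm: "Suc i \<le> z (Suc m) mod h m" "z (Suc m) mod h m + l \<le> h m + Suc i" if "m \<ge> n" for m
    using z that by (auto simp: level_def)
  have pos: "z (Suc m) > 0" if "m \<ge> n" for m
    using zm(1)[OF that] by (cases "z (Suc m)") auto
  have mod: "z (Suc m) mod h m = Suc ((z (Suc m) - 1) mod h m)" if "m \<ge> n" for m
    using zm(1)[OF that] pos[OF that] mod_Suc[of "z (Suc m) - 1" "h m"] by (simp split: if_splits)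
  have inner: "Suc ((z (Suc m) - 1) mod h m) < h m" if "m \<ge> n" for m
    using mod[OF that] h_pos[of m] by (metis mod_less_divisor)
  have succ: "Suc (v m) mod h m = z m" if "m \<ge> n" for m
    using phi_Suc[OF inner[OF that]] pos[OF that] spaceD(2)[OF zX, of m] by (simp add: v_def)
  have vS: "v (Suc m) = z (Suc m) - 1" if "m \<ge> n" for m
    using succ[of "Suc m"] pos[OF that] phi_less[of "Suc m"] that
    by (auto simp: mod_Suc v_def split: if_splits)
  have "\<exists>x\<in>X. \<forall>m\<ge>n. x m = v m"
  proof (rule extend_tail)
    show "v m < h m" for m by (simp add: v_def phi_less)
    show "\<phi> m (v (Suc m)) = v m" if "m \<ge> n" for m using vS[OF that] by (simp add: v_def[of m])
  qed
  then obtain x where x: "x \<in> X" "\<And>m. m \<ge> n \<Longrightarrow> x m = v m" by blast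
  have "T x = z"
    by (rule iceberg_T_eqI[OF x(1) zX, of n]) (use x(2) inner vS succ in auto)
  moreover have "v n = (a + i) mod h n"
  proof -
    have "Suc (v n) mod h n = Suc (a + i) mod h n"
      using succ[of n] z by (simp add: level_def)
    moreover have "v n < h n" by (simp add: v_def phi_less)
    ultimately show ?thesis by (auto simp: mod_Suc split: if_splits)
  qed
  then have "x \<in> level n a l i"
    using x vS mod zm by (auto simp: level_def)
  ultimately show "z \<in> T ` level n a l i" by blast
qed

lemma iceberg_T_pow_level: "i < l \<Longrightarrow> (T ^^ i) ` level n a l 0 = level n a l i"
proof (induction i)
  case (Suc i)
  have "(T ^^ Suc i) ` level n a l 0 = T ` (T ^^ i) ` level n a l 0"
    by (simp add: image_comp)
  with Suc show ?case by (simp add: iceberg_T_image_level)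
qed simp

lemma tower_union_level: "tower_union T (level n a l 0) l = (\<Union>i<l. level n a l i)"
  unfolding tower_union_def by (intro SUP_cong) (auto simp: iceberg_T_pow_level)

lemma level_position_inj:
  assumes "l \<le> h n" "i < l" "j < l" "(a + i) mod h n = (a + j) mod h n"
  shows "i = j"
  using assms(2-)
proof (induction i j rule: linorder_wlog)
  case (le i j)
  then have "h n dvd (a + j) - (a + i)"
    using mod_eq_dvd_iff_nat[of "a + i" "a + j" "h n"] by simp
  with le assms(1) show ?case using dvd_imp_le[of "h n" "j - i"] by (cases "i = j") auto
next
  case (sym i j)
  from sym(1)[OF sym(3,2) sym(4)[symmetric]] show ?case by simp
qed

section \<open>Cylinders\<close>

definition cyl :: "nat \<Rightarrow> nat set \<Rightarrow> (nat \<Rightarrow> nat) set" where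
  "cyl n S = {x \<in> X. x n \<in> S}"

lemma cyl_lift:
  assumes "n \<le> m"
  shows "\<exists>S'. finite S' \<and> cyl n S = cyl m S'"
  using assms
proof (induction m rule: dec_induct)
  case base
  have "cyl n S = cyl n (S \<inter> {..<h n})" using spaceD(1) by (auto simp: cyl_def)
  then show ?case by blast
next
  case (step m)
  then obtain S' where S': "cyl n S = cyl m S'" by blast
  also have "\<dots> = cyl (Suc m) {b \<in> {..<h (Suc m)}. \<phi> m b \<in> S'}"
    using spaceD by (auto simp: cyl_def)
  finally show ?case by (intro exI[of _ "{b \<in> {..<h (Suc m)}. \<phi> m b \<in> S'}"]) auto
qed

text \<open>
  Coordinate \<open>n\<close> is constant on each level of a tower of stage \<open>n\<close> and it determines all earlier
  coordinates; so the levels resolve the cylinders of these stages without any error.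
\<close>

lemma tower_measurable_cyl:
  assumes "n \<le> m" "cyl n S \<in> sets M"
  shows "tower_measurable M T (level m a l 0) l (cyl n S)"
proof -
  obtain S' where S': "cyl n S = cyl m S'" using cyl_lift[OF assms(1)] by blast
  let ?J = "{i \<in> {..<l}. (a + i) mod h m \<in> S'}"
  have "cyl m S' \<inter> (\<Union>i<l. level m a l i) = (\<Union>i\<in>?J. level m a l i)"
    by (auto simp: cyl_def level_def)
  also have "\<dots> = (\<Union>i\<in>?J. (T ^^ i) ` level m a l 0)"
    by (intro SUP_cong) (auto simp: iceberg_T_pow_level)
  finally show ?thesis
    unfolding tower_measurable_def tower_union_level S'
    using assms(2) by (intro conjI exI[of _ ?J]) (auto simp: S')
qed

end

locale iceberg_prob = iceberg + prob_space M for M :: "(nat \<Rightarrow> nat) measure" +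
  assumes measure: "iceberg_measure q \<alpha> M"
begin

lemma sets_M: "sets M = sets (restrict_space borel X)"
  using measure by (simp add: iceberg_measure_def)

lemma space_M: "space M = X"
  using sets_eq_imp_space_eq[OF sets_M] by (simp add: space_restrict_space)

lemma cyl_sets [measurable]: "cyl n S \<in> sets M"
proof -
  have "(\<lambda>x::nat \<Rightarrow> nat. x n) \<in> measurable borel borel"
    by (intro borel_measurable_continuous_onI continuous_on_product_coordinates)
  then have "(\<lambda>x::nat \<Rightarrow> nat. x n) -` S \<inter> space borel \<in> sets borel"
    by (rule measurable_sets) (simp add: sets_borel_eq_count_space)
  then have "X \<inter> (\<lambda>x. x n) -` S \<in> sets M"
    by (simp add: sets_M sets_restrict_space)
  then show ?thesis by (simp add: cyl_def vimage_def Int_def)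
qed

lemma measure_cyl:
  assumes "S \<subseteq> {..<h n}"
  shows "prob (cyl n S) = real (card S) / real (h n)"
proof -
  have fin: "finite S" using assms finite_subset by blast
  have "cyl n S = (\<Union>t\<in>S. cyl n {t})" by (auto simp: cyl_def)
  also have "prob \<dots> = (\<Sum>t\<in>S. prob (cyl n {t}))"
    using fin cyl_sets
    by (intro finite_measure_finite_Union) (auto simp: disjoint_family_on_def, auto simp: cyl_def)
  also have "\<dots> = (\<Sum>t\<in>S. 1 / real (h n))"
  proof (intro sum.cong refl)
    fix t assume "t \<in> S"
    then show "prob (cyl n {t}) = 1 / real (h n)"
      using measure assms by (auto simp: iceberg_measure_def cyl_def)
  qed
  finally show ?thesis by simp
qed

text \<open>
  The sets that cylinders approximate form a sigma-algebra. For a countable union only finitely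
  many members matter up to a small error, and finitely many cylinders have a common stage.
\<close>

lemma cyl_dense:
  assumes "A \<in> sets M" "e > 0"
  shows "\<exists>n S. finite S \<and> prob (sym_diff (cyl n S) A) < e"
proof -
  have gen: "sets M = sigma_sets X (range (\<lambda>(n, S). cyl n S))"
  proof
    let ?G = "{{f \<in> Pi\<^sub>E UNIV (\<lambda>i. UNIV). f i \<in> A} | (i::nat) A. A \<in> sets (borel :: nat measure)}"
    have "sets (borel :: (nat \<Rightarrow> nat) measure) = sets (Pi\<^sub>M UNIV (\<lambda>_. borel))"
      by (simp add: sets_PiM_equal_borel)
    also have "\<dots> = sigma_sets UNIV ?G"
      by (simp add: sets_PiM_single)
    finally have "sets M = {(\<lambda>x. x) -` A \<inter> X |A. A \<in> sigma_sets UNIV ?G}"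
      unfolding sets_M sets_restrict_space by blast
    also have "\<dots> = sigma_sets X {(\<lambda>x. x) -` A \<inter> X |A. A \<in> ?G}"
      by (rule sigma_sets_vimage_commute) simp
    also have "\<dots> \<subseteq> sigma_sets X (range (\<lambda>(n, S). cyl n S))"
    proof (rule sigma_sets_mono')
      have "{f \<in> Pi\<^sub>E UNIV (\<lambda>i. UNIV). f i \<in> A} \<inter> X = cyl i A" for i A
        by (auto simp: cyl_def)
      then show "{(\<lambda>x. x) -` A \<inter> X |A. A \<in> ?G} \<subseteq> range (\<lambda>(n, S). cyl n S)"
        by force
    qed
    finally show "sets M \<subseteq> sigma_sets X (range (\<lambda>(n, S). cyl n S))" .
    show "sigma_sets X (range (\<lambda>(n, S). cyl n S)) \<subseteq> sets M"
      unfolding space_M[symmetric] by (intro sets.sigma_sets_subset) auto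
  qed
  have "\<forall>e>0. \<exists>n S. finite S \<and> prob (sym_diff (cyl n S) A) < e"
    using assms(1)[unfolded gen]
  proof induction
    case (Basic A)
    then obtain n S where "A = cyl n S" by auto
    moreover obtain S' where "finite S'" "cyl n S = cyl n S'" using cyl_lift[of n n S] by auto
    ultimately show ?case by (auto intro!: exI[of _ n] exI[of _ S'])
  next
    case Empty
    show ?case by (auto intro!: exI[of _ "{}::nat set"] simp: cyl_def)
  next
    case (Compl A)
    show ?case
    proof (intro allI impI)
      fix e :: real assume "e > 0"
      then obtain n S where S: "prob (sym_diff (cyl n S) A) < e" using Compl by blast
      have "A \<subseteq> X" using Compl(1) sets.sets_into_space[of A M] by (simp add: gen space_M)
      then have "sym_diff (cyl n ({..<h n} - S)) (X - A) = sym_diff (cyl n S) A"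
        using spaceD(1) by (auto simp: cyl_def)
      with S show "\<exists>n S. finite S \<and> prob (sym_diff (cyl n S) (X - A)) < e"
        by (intro exI[of _ n] exI[of _ "{..<h n} - S"]) simp
    qed
  next
    case (Union A)
    have A: "A i \<in> sets M" for i using Union(1) by (simp add: gen)
    show ?case
    proof (intro allI impI)
      fix e :: real assume e: "e > 0"
      have "(\<lambda>k. prob (\<Union>i<k. A i)) \<longlonglongrightarrow> prob (\<Union>k. \<Union>i<k. A i)"
        using A by (intro finite_Lim_measure_incseq incseq_SucI) (auto simp: less_Suc_eq)
      also have "(\<Union>k. \<Union>i<k. A i) = (\<Union>i. A i)" by auto
      finally have "\<forall>\<^sub>F k in sequentially. prob (\<Union>i<k. A i) > prob (\<Union>i. A i) - e / 2"
        using e by (intro order_tendstoD(1)) auto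
      then obtain k where k: "prob (\<Union>i<k. A i) > prob (\<Union>i. A i) - e / 2"
        using eventually_happens'[OF sequentially_bot] by blast
      have tail: "prob (sym_diff (\<Union>i<k. A i) (\<Union>i. A i)) < e / 2"
      proof -
        have "sym_diff (\<Union>i<k. A i) (\<Union>i. A i) = (\<Union>i. A i) - (\<Union>i<k. A i)" by auto
        also have "prob \<dots> = prob (\<Union>i. A i) - prob (\<Union>i<k. A i)"
          using A by (intro finite_measure_Diff) auto
        finally show ?thesis using k by simp
      qed
      let ?e = "e / (2 * real (Suc k))"
      have "?e > 0" using e by simp
      then have "\<forall>i. \<exists>n S. finite S \<and> prob (sym_diff (cyl n S) (A i)) < ?e" using Union(2) by blast
      then obtain N S where S: "\<And>i. finite (S i)" "\<And>i. prob (sym_diff (cyl (N i) (S i)) (A i)) < ?e"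
        by metis
      define m where "m = Max (N ` {..<Suc k})"
      have "N i \<le> m" if "i < k" for i unfolding m_def using that by (intro Max_ge) auto
      then have "\<forall>i. \<exists>S'. i < k \<longrightarrow> finite S' \<and> cyl (N i) (S i) = cyl m S'"
        using cyl_lift by blast
      then obtain S' where S': "\<And>i. i < k \<Longrightarrow> finite (S' i)" "\<And>i. i < k \<Longrightarrow> cyl (N i) (S i) = cyl m (S' i)"
        by metis
      let ?S = "\<Union>i<k. S' i"
      have "sym_diff (cyl m ?S) (\<Union>i<k. A i) \<subseteq> (\<Union>i\<in>{..<k}. sym_diff (cyl m (S' i)) (A i))"
        by (auto simp: cyl_def)
      also have "\<dots> = (\<Union>i\<in>{..<k}. sym_diff (cyl (N i) (S i)) (A i))" using S'(2) by simp
      finally have "prob (sym_diff (cyl m ?S) (\<Union>i<k. A i))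
          \<le> prob (\<Union>i\<in>{..<k}. sym_diff (cyl (N i) (S i)) (A i))"
        using A by (intro finite_measure_mono) auto
      also have "\<dots> \<le> (\<Sum>i<k. prob (sym_diff (cyl (N i) (S i)) (A i)))"
        using A by (intro finite_measure_subadditive_finite) auto
      also have "\<dots> \<le> (\<Sum>i<k. ?e)" using S(2) by (intro sum_mono less_imp_le)
      also have "\<dots> < e / 2" using e by (simp add: field_simps)
      finally have "prob (sym_diff (cyl m ?S) (\<Union>i. A i)) < e"
        using tail measure_sym_diff_triangle[of "cyl m ?S" "\<Union>i<k. A i" "\<Union>i. A i"] A by force
      then show "\<exists>n S. finite S \<and> prob (sym_diff (cyl n S) (\<Union>i. A i)) < e"
        using S'(1) by (intro exI[of _ m] exI[of _ ?S]) auto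
    qed
  qed
  with assms(2) show ?thesis by blast
qed

section \<open>The measure of the towers\<close>

lemma level_sets: "level n a l i \<in> sets M"
proof -
  have "level n a l i = cyl n {(a + i) mod h n} \<inter>
      (\<Inter>m\<in>{n..}. cyl (Suc m) {b. i \<le> b mod h m \<and> b mod h m + l \<le> h m + i})"
    by (auto simp: level_def cyl_def)
  then show ?thesis by (auto intro!: sets.Int sets.countable_INT')
qed

lemma rokhlin_tower_level:
  assumes "1 \<le> l" "l \<le> h n"
  shows "rokhlin_tower M T (level n a l 0) l"
  unfolding rokhlin_tower_def disjoint_family_on_def
  using assms level_sets level_position_inj[OF assms(2)]
  by (auto simp: iceberg_T_pow_level) (auto simp: level_def)

text \<open>Every block of length \<open>h m\<close> has at most \<open>2 * l\<close> such places, \<open>l\<close> at either end.\<close>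

lemma prob_near_block_boundary:
  "prob (cyl (Suc m) {b. b mod h m < l \<or> h m < b mod h m + l}) \<le> 2 * real l / real (h m)"
proof -
  let ?B = "{b \<in> {..<h (Suc m)}. b mod h m < l \<or> h m < b mod h m + l}"
  let ?R = "{..<q m} \<times> ({..<l} \<union> {h m - l..<h m})"
  have "(\<lambda>b. (b div h m, b mod h m)) ` ?B \<subseteq> ?R"
    using h_pos[of m] by (auto simp: iceberg_h_Suc less_mult_imp_div_less)
  moreover have "inj_on (\<lambda>b. (b div h m, b mod h m)) ?B"
  proof (rule inj_onI)
    fix b c assume "(b div h m, b mod h m) = (c div h m, c mod h m)"
    then have "b div h m * h m + b mod h m = c div h m * h m + c mod h m" by simp
    then show "b = c" by (simp only: div_mult_mod_eq)
  qed
  ultimately have "card ?B \<le> card ?R" by (intro card_inj_on_le[where B = ?R]) auto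
  also have "\<dots> \<le> q m * (2 * l)"
  proof -
    have "card ({..<l} \<union> {h m - l..<h m}) \<le> l + (h m - (h m - l))"
      using card_Un_le[of "{..<l}" "{h m - l..<h m}"] by simp
    also have "\<dots> \<le> 2 * l" by arith
    finally show ?thesis by (simp add: card_cartesian_product)
  qed
  finally have "card ?B \<le> q m * (2 * l)" .
  from of_nat_mono[OF this, where 'a = real]
  have "real (card ?B) \<le> real (q m) * (2 * real l)" by simp
  then have "real (card ?B) / real (h (Suc m)) \<le> real (q m) * (2 * real l) / real (h (Suc m))"
    by (intro divide_right_mono) auto
  also have "\<dots> = 2 * real l / real (h m)"
    using q_ge_2[of m] by (simp add: iceberg_h_Suc)
  also have "real (card ?B) / real (h (Suc m)) = prob (cyl (Suc m) ?B)"
    by (intro measure_cyl[symmetric]) auto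
  also have "cyl (Suc m) ?B = cyl (Suc m) {b. b mod h m < l \<or> h m < b mod h m + l}"
    using spaceD(1) by (auto simp: cyl_def)
  finally show ?thesis .
qed

text \<open>
  The bounds of the later stages decrease geometrically, and the first of them is at most
  \<open>1 / q n\<close>, since \<open>h (n + 1) = q n * h n\<close>.
\<close>

lemma prob_near_later_boundary:
  assumes "2 * l \<le> h n"
  shows "prob (\<Union>k. cyl (Suc (Suc n + k)) {b. b mod h (Suc n + k) < l \<or>
      h (Suc n + k) < b mod h (Suc n + k) + l}) \<le> 2 / real (q n)"
    (is "prob (\<Union>k. ?B k) \<le> _")
proof -
  have le: "prob (?B k) \<le> (1 / real (q n)) * (1 / 2) ^ k" for k
  proof -
    have g: "2 ^ k * (q n * h n) \<le> h (Suc n + k)"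
      using h_growth[of k "Suc n"] by (simp add: iceberg_h_Suc)
    have "prob (?B k) \<le> 2 * real l / real (h (Suc n + k))" by (rule prob_near_block_boundary)
    also have "\<dots> \<le> real (h n) / (2 ^ k * (real (q n) * real (h n)))"
    proof (intro frac_le)
      show "2 * real l \<le> real (h n)" using assms by linarith
      show "2 ^ k * (real (q n) * real (h n)) \<le> real (h (Suc n + k))"
        using of_nat_mono[OF g, where 'a = real] by simp
      show "0 < 2 ^ k * (real (q n) * real (h n))" using h_pos[of n] q_ge_2[of n] by simp
    qed simp
    also have "\<dots> = (1 / real (q n)) * (1 / 2) ^ k" using h_pos[of n] by (simp add: power_divide)
    finally show ?thesis .
  qed
  have sg: "(\<lambda>k. (1 / real (q n)) * (1 / 2) ^ k) sums ((1 / real (q n)) * 2)"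
    using geometric_sums[of "1 / 2 :: real"] by (intro sums_mult) simp
  have sm: "summable (\<lambda>k. prob (?B k))"
    by (rule summable_comparison_test'[OF sums_summable[OF sg]]) (use le in simp)
  have "prob (\<Union>k. ?B k) \<le> (\<Sum>k. prob (?B k))"
    using sm by (intro finite_measure_subadditive_countably) auto
  also have "\<dots> \<le> (\<Sum>k. (1 / real (q n)) * (1 / 2) ^ k)"
    by (rule suminf_le[OF le sm sums_summable[OF sg]])
  also have "\<dots> = 2 / real (q n)" using sums_unique[OF sg] by simp
  finally show ?thesis .
qed

text \<open>
  A window of length \<open>l = h n div 2\<close> in the cycle of length \<open>h n\<close> is cut by the rotation of a block if
  the end of the block falls inside it. The windows starting at \<open>0\<close> and at \<open>l\<close> are disjoint, so a
  block cuts at most one of them, and one of the two is intact in at least half of the blocks.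
\<close>

lemma intact_window:
  assumes "l = h n div 2"
  shows "\<exists>a. q n \<le> 2 * card {y \<in> {..<q n}. (a + \<alpha> n y) mod h n + l \<le> h n}"
proof -
  define Y where "Y a = {y \<in> {..<q n}. (a + \<alpha> n y) mod h n + l \<le> h n}" for a
  have fin: "finite (Y a)" for a by (simp add: Y_def)
  have "{..<q n} \<subseteq> Y 0 \<union> Y l"
  proof
    fix y assume "y \<in> {..<q n}"
    then have y: "y < q n" "\<alpha> n y < h n" by (auto intro: alpha_less)
    show "y \<in> Y 0 \<union> Y l"
    proof (cases "\<alpha> n y + l \<le> h n")
      case True
      with y show ?thesis by (simp add: Y_def)
    next
      case False
      then have "(l + \<alpha> n y) mod h n = l + \<alpha> n y - h n"
        using y assms by (subst mod_if) (simp add: le_mod_geq)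
      with False y assms show ?thesis by (simp add: Y_def)
    qed
  qed
  then have "q n \<le> card (Y 0 \<union> Y l)" using card_mono[of "Y 0 \<union> Y l" "{..<q n}"] fin by simp
  also have "\<dots> \<le> card (Y 0) + card (Y l)" by (rule card_Un_le)
  finally obtain a where "q n \<le> 2 * card (Y a)"
    by (cases "card (Y 0) \<le> card (Y l)") (auto intro: that[of 0] that[of l])
  then show ?thesis unfolding Y_def by blast
qed

text \<open>
  What membership in some level of the tower demands of the coordinates up to stage \<open>n + 1\<close>, where
  \<open>b\<close> stands for the coordinate of stage \<open>n + 1\<close>.
\<close>

definition tower_positions :: "nat \<Rightarrow> nat \<Rightarrow> nat \<Rightarrow> nat set" where
  "tower_positions n a l = {b \<in> {..<h (Suc n)}. \<exists>i<l. \<phi> n b = (a + i) mod h n \<and>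
      i \<le> b mod h n \<and> b mod h n + l \<le> h n + i}"

text \<open>
  Each block that leaves the window intact contributes \<open>l\<close> consecutive positions, starting at the
  place \<open>(a + \<alpha> n y) mod h n\<close> to which the rotation of the block moves \<open>a\<close>.
\<close>

lemma card_tower_positions:
  "card {y \<in> {..<q n}. (a + \<alpha> n y) mod h n + l \<le> h n} * l \<le> card (tower_positions n a l)"
proof -
  define Y where "Y = {y \<in> {..<q n}. (a + \<alpha> n y) mod h n + l \<le> h n}"
  define g where "g = (\<lambda>(y, i). y * h n + ((a + \<alpha> n y) mod h n + i))"
  have small: "(a + \<alpha> n y) mod h n + i < h n" if "y \<in> Y" "i < l" for y i
    using that by (auto simp: Y_def)
  have "inj_on g (Y \<times> {..<l})"
  proof (rule inj_onI, clarify)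
    fix y i y' i' assume *: "y \<in> Y" "y' \<in> Y" "i < l" "i' < l" "g (y, i) = g (y', i')"
    have "g (y, i) div h n = y" "g (y', i') div h n = y'"
      using small[OF *(1,3)] small[OF *(2,4)] by (auto simp: g_def)
    with * show "y = y' \<and> i = i'" by (simp add: g_def)
  qed
  moreover have "g ` (Y \<times> {..<l}) \<subseteq> tower_positions n a l"
  proof clarify
    fix y i assume *: "y \<in> Y" "i < l"
    let ?s = "(a + \<alpha> n y) mod h n"
    have "((a + i) mod h n + \<alpha> n y) mod h n = (?s + i) mod h n"
      by (simp add: mod_simps ac_simps)
    then have "y * h n + ((a + i) mod h n + \<alpha> n y) mod h n = g (y, i)"
      using small[OF *] by (simp add: g_def)
    moreover have "\<phi> n (y * h n + ((a + i) mod h n + \<alpha> n y) mod h n) = (a + i) mod h n"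
      using h_pos q_ge_2 by (intro iceberg_phi_point) auto
    ultimately have "\<phi> n (g (y, i)) = (a + i) mod h n" by simp
    moreover have "g (y, i) mod h n = ?s + i" using small[OF *] by (simp add: g_def)
    moreover have "g (y, i) < h (Suc n)"
    proof -
      have "g (y, i) < Suc y * h n" using small[OF *] by (simp add: g_def)
      also have "\<dots> \<le> h (Suc n)"
        unfolding iceberg_h_Suc using *(1) by (intro mult_right_mono) (auto simp: Y_def)
      finally show ?thesis .
    qed
    ultimately show "g (y, i) \<in> tower_positions n a l"
      using * by (auto simp: tower_positions_def Y_def)
  qed
  moreover have "finite (tower_positions n a l)" by (simp add: tower_positions_def)
  ultimately have "card (Y \<times> {..<l}) \<le> card (tower_positions n a l)" by (rule card_inj_on_le)
  then show ?thesis by (simp add: card_cartesian_product Y_def)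
qed

text \<open>
  Intact windows in half of the blocks, each filling half of its block, give the constant \<open>1/4\<close>;
  the rounding in \<open>h n div 2\<close> costs at most \<open>1 / h n\<close>. Points close to a block boundary of a later
  stage have to be discarded, which costs the last term.
\<close>

lemma prob_tower_union:
  assumes "l = h n div 2"
  shows "\<exists>a. prob (tower_union T (level n a l 0) l) \<ge> 1 / 4 - 1 / real (h n) - 2 / real (q n)"
proof -
  obtain a where a: "q n \<le> 2 * card {y \<in> {..<q n}. (a + \<alpha> n y) mod h n + l \<le> h n}" (is "_ \<le> 2 * ?c")
    using intact_window[OF assms] by blast
  let ?G = "tower_positions n a l"
  have "real (q n) / 2 * ((real (h n) - 1) / 2) \<le> real ?c * real l"
    using a assms h_pos[of n] by (intro mult_mono) (linarith | simp)+
  also have "\<dots> \<le> real (card ?G)"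
    using of_nat_mono[OF card_tower_positions, where 'a = real] by simp
  finally have "real (q n) * (real (h n) - 1) / 4 \<le> real (card ?G)" by simp
  then have "real (q n) * (real (h n) - 1) / 4 / real (h (Suc n)) \<le> real (card ?G) / real (h (Suc n))"
    by (intro divide_right_mono) auto
  moreover have "real (q n) * (real (h n) - 1) / 4 / real (h (Suc n)) = 1 / 4 - 1 / (4 * real (h n))"
    using q_ge_2[of n] h_pos[of n] by (simp add: iceberg_h_Suc field_simps)
  moreover have "prob (cyl (Suc n) ?G) = real (card ?G) / real (h (Suc n))"
    by (rule measure_cyl) (auto simp: tower_positions_def)
  moreover have "1 / (4 * real (h n)) \<le> 1 / real (h n)" using h_pos[of n] by (simp add: field_simps)
  ultimately have G: "1 / 4 - 1 / real (h n) \<le> prob (cyl (Suc n) ?G)" by linarith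
  define L where "L = (\<Union>i<l. level n a l i)"
  define B where "B = (\<Union>k. cyl (Suc (Suc n + k)) {b. b mod h (Suc n + k) < l \<or>
      h (Suc n + k) < b mod h (Suc n + k) + l})"
  have sets: "L \<in> events" "B \<in> events"
    unfolding L_def B_def by (auto intro!: sets.finite_UN level_sets)
  have bad: "prob B \<le> 2 / real (q n)"
    unfolding B_def using assms by (intro prob_near_later_boundary) simp
  have "cyl (Suc n) ?G \<subseteq> L \<union> B"
  proof
    fix x assume x: "x \<in> cyl (Suc n) ?G"
    then have xX: "x \<in> X" by (simp add: cyl_def)
    obtain i where i: "i < l" "x n = (a + i) mod h n"
      "i \<le> x (Suc n) mod h n" "x (Suc n) mod h n + l \<le> h n + i"
      using x spaceD(2)[OF xX, of n] by (auto simp: cyl_def tower_positions_def)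
    show "x \<in> L \<union> B"
    proof (cases "x \<in> B")
      case False
      have "i \<le> x (Suc m) mod h m \<and> x (Suc m) mod h m + l \<le> h m + i" if "m \<ge> n" for m
      proof (cases "m = n")
        case False
        with that obtain k where m: "m = Suc n + k" using le_Suc_ex[of "Suc n" m] by auto
        have "\<not> (x (Suc m) mod h m < l \<or> h m < x (Suc m) mod h m + l)"
          using \<open>x \<notin> B\<close> xX unfolding B_def cyl_def m by blast
        with i(1) show ?thesis by linarith
      qed (use i in simp)
      then have "x \<in> level n a l i" using xX i by (simp add: level_def)
      with i(1) show ?thesis by (auto simp: L_def)
    qed simp
  qed
  then have "prob (cyl (Suc n) ?G) \<le> prob (L \<union> B)"
    using sets by (intro finite_measure_mono) auto
  also have "\<dots> \<le> prob L + prob B"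
    using sets by (rule measure_Un_le)
  finally show ?thesis
    using G bad by (intro exI[of _ a]) (simp add: tower_union_level L_def)
qed

lemma local_rank_ge_quarter:
  assumes q: "filterlim q at_top sequentially"
  shows "local_rank M T \<ge> 1 / 4"
proof -
  define D where "D k = (let (n, s) = from_nat k :: nat \<times> nat list in cyl n (set s))" for k
  have D: "D k \<in> sets M" for k by (simp add: D_def split: prod.split)
  have dense: "\<exists>k. prob (sym_diff (D k) A) < e" if "A \<in> sets M" "e > 0" for A e
  proof -
    obtain n S where S: "finite S" "prob (sym_diff (cyl n S) A) < e" using cyl_dense[OF \<open>A \<in> sets M\<close> \<open>e > 0\<close>] by blast
    obtain s where "set s = S" using finite_list[OF S(1)] by blast
    then have "D (to_nat (n, s)) = cyl n S" by (simp add: D_def)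
    with S(2) show ?thesis by metis
  qed
  obtain a where a: "\<And>n. prob (tower_union T (level n (a n) (h n div 2) 0) (h n div 2))
      \<ge> 1 / 4 - 1 / real (h n) - 2 / real (q n)"
    using prob_tower_union[OF refl] by metis
  define p where "p n = prob (tower_union T (level n (a n) (h n div 2) 0) (h n div 2))" for n
  have "bounded (range p)"
    unfolding bounded_iff p_def using prob_le_1 by (intro exI[of _ 1]) auto
  then obtain \<beta> r where r: "strict_mono r" "(p \<circ> r) \<longlonglongrightarrow> \<beta>"
    using bounded_imp_convergent_subsequence by blast
  have real_q: "filterlim (\<lambda>n. real (q n)) at_top sequentially"
    by (rule filterlim_compose[OF filterlim_real_sequentially q])
  have real_h: "filterlim (\<lambda>n. real (h n)) at_top sequentially"
  proof (rule filterlim_at_top_mono[OF filterlim_real_sequentially], rule always_eventually, rule allI)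
    fix n
    have "n < 2 ^ n" by simp
    also have "\<dots> \<le> h n" using h_growth[of n 0] by (simp add: iceberg_h_def)
    finally show "real n \<le> real (h n)" by simp
  qed
  have "(\<lambda>n. 1 / 4 - 1 / real (h n) - 2 / real (q n)) \<longlonglongrightarrow> 1 / 4 - 0 - 0"
    by (intro tendsto_diff tendsto_const real_tendsto_divide_at_top[OF tendsto_const] real_q real_h)
  then have "(\<lambda>n. 1 / 4 - 1 / real (h n) - 2 / real (q n)) \<longlonglongrightarrow> 1 / 4" by simp
  from LIMSEQ_subseq_LIMSEQ[OF this r(1)] have quarter: "1 / 4 \<le> \<beta>"
    using a by (intro LIMSEQ_le[OF _ r(2)]) (auto simp: p_def)
  have "local_rank_value M T \<beta>"
  proof (rule local_rank_valueI[OF D dense])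
    fix e :: real and K assume e: "e > 0"
    \<comment> \<open>From stage \<open>N\<close> on, the first \<open>K\<close> cylinders are resolved; stage 0 is excluded as its towers have height 0.\<close>
    define N where "N = Max (insert 1 ((\<lambda>k. fst (from_nat k :: nat \<times> nat list)) ` {..<K}))"
    have "\<forall>\<^sub>F j in sequentially. \<bar>p (r j) - \<beta>\<bar> < e"
      using tendstoD[OF r(2) e] by (simp add: dist_real_def)
    then obtain j where j: "\<bar>p (r j) - \<beta>\<bar> < e" "j \<ge> N"
      using eventually_happens'[OF sequentially_bot eventually_conj[OF _ eventually_ge_at_top[of N]]] by blast
    define n where "n = r j"
    have "N \<le> n" using j(2) seq_suble[OF r(1), of j] by (simp add: n_def)
    moreover have "1 \<le> N" by (simp add: N_def)
    ultimately have "1 \<le> n" by simp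
    have "h n \<ge> 2 ^ n" using h_growth[of n 0] by (simp add: iceberg_h_def)
    moreover have "(2::nat) \<le> 2 ^ n" using \<open>1 \<le> n\<close> self_le_power[of 2 n] by simp
    ultimately have "1 \<le> h n div 2" "h n div 2 \<le> h n" by auto
    then have "rokhlin_tower M T (level n (a n) (h n div 2) 0) (h n div 2)"
      by (rule rokhlin_tower_level)
    moreover have "\<exists>A. tower_measurable M T (level n (a n) (h n div 2) 0) (h n div 2) A \<and>
        prob (sym_diff A (D k)) < e" if "k < K" for k
    proof -
      obtain i s where D_k: "from_nat k = (i :: nat, s :: nat list)" by (meson surj_pair)
      have "fst (from_nat k :: nat \<times> nat list) \<le> N" unfolding N_def using that by (intro Max_ge) auto
      with D_k \<open>N \<le> n\<close> have "i \<le> n" by simp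
      then have "tower_measurable M T (level n (a n) (h n div 2) 0) (h n div 2) (D k)"
        using tower_measurable_cyl D_k by (simp add: D_def)
      then show ?thesis using e by (intro exI[of _ "D k"]) simp
    qed
    ultimately show "\<exists>C l. rokhlin_tower M T C l \<and> \<bar>prob (tower_union T C l) - \<beta>\<bar> < e \<and>
      (\<forall>k<K. \<exists>A. tower_measurable M T C l A \<and> prob (sym_diff A (D k)) < e)"
      using j(1) unfolding p_def n_def by blast
  qed
  then have "\<beta> \<le> local_rank M T"
    by (intro local_rank_value_le_local_rank[of D]) (auto intro: D dense)
  with quarter show ?thesis by simp
qed

end

theorem theorem26:
  fixes q :: "nat \<Rightarrow> nat" and \<alpha> :: "nat \<Rightarrow> nat \<Rightarrow> nat" and M :: "(nat \<Rightarrow> nat) measure"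
  assumes "\<And>n. q n \<ge> 2"
    and "\<And>n y. y < q n \<Longrightarrow> \<alpha> n y < iceberg_h q n"
    and "iceberg_measure q \<alpha> M"
    and "filterlim q at_top sequentially"
  shows "local_rank M (iceberg_T q \<alpha>) \<ge> 1 / 4"
proof -
  interpret prob_space M using assms(3) by (simp add: iceberg_measure_def)
  interpret iceberg_prob q \<alpha> M by unfold_locales (use assms in auto)
  show ?thesis using assms(4) by (rule local_rank_ge_quarter)
qed

end
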